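(* For every fixed $y_0>0$, the operator $$B_{y_0}=I-e^{-y_0\sqrt L}$$ is bounded, self-adjoint, positive, and boundedly invertible on $L^2(0,\pi)$. Moreover, $$(1-e^{-y_0})\|v\|^2\le (B_{y_0}v,v)\le \|v\|^2,\qquad v\in L^2(0,\pi),$$ and $$\|B_{y_0}^{-1}\|_{\mathcal L(L^2,L^2)}=\frac{1}{1-e^{-y_0}} .$$
   Context: $L=-\frac{d^2}{dx^2}$ on $L^2(0,\pi)$ with domain $D(L)=H^2(0,\pi)\cap H_0^1(0,\pi)$; its normalized eigenfunctions are $\phi_n(x)=\sqrt{2/\pi}\,\sin(nx)$ with $L\phi_n=n^2\phi_n$, $n=1,2,\dots$. Functions of $L$ are defined spectrally, so that $e^{-y_0\sqrt L}v=\sum_{n\ge1}e^{-ny_0}(v,\phi_n)\phi_n$ and $B_{y_0}\phi_n=(1-e^{-ny_0})\phi_n$. Here $(\cdot,\cdot)$ and $\|\cdot\|$ are the usual inner product and norm of $L^2(0,\pi)$, and $\|\cdot\|_{\mathcal L(L^2,L^2)}$ is the operator norm on $L^2(0,\pi)$. *)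

theory Defs
  imports "HOL-Analysis.Analysis"
begin

abbreviation M_pi :: "real measure" where
  "M_pi \<equiv> lebesgue_on {0<..<pi}"

definition L2_fun :: "(real \<Rightarrow> real) set" where
  "L2_fun = {f \<in> borel_measurable M_pi. integrable M_pi (\<lambda>x. (f x)\<^sup>2)}"

definition L2_eq :: "(real \<Rightarrow> real) \<Rightarrow> (real \<Rightarrow> real) \<Rightarrow> bool" where
  "L2_eq f g \<longleftrightarrow> f \<in> L2_fun \<and> g \<in> L2_fun \<and> (AE x in M_pi. f x = g x)"

lemma L2_fun_mult_integrable:
  assumes "f \<in> L2_fun" "g \<in> L2_fun"
  shows "integrable M_pi (\<lambda>x. f x * g x)"
proof -
  have "integrable M_pi (\<lambda>x. (f x)\<^sup>2 + (g x)\<^sup>2)"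
    using assms by (auto simp: L2_fun_def)
  then show ?thesis
  proof (rule Bochner_Integration.integrable_bound)
    show "(\<lambda>x. f x * g x) \<in> borel_measurable M_pi"
      using assms by (auto simp: L2_fun_def)
    have "\<bar>a * b\<bar> \<le> \<bar>a\<^sup>2 + b\<^sup>2\<bar>" for a b :: real
    proof -
      have "0 \<le> (\<bar>a\<bar> - \<bar>b\<bar>)\<^sup>2" by simp
      then have "2 * (\<bar>a\<bar> * \<bar>b\<bar>) \<le> a\<^sup>2 + b\<^sup>2" by (simp add: power2_diff)
      moreover have "0 \<le> \<bar>a\<bar> * \<bar>b\<bar>" by simp
      ultimately show ?thesis unfolding abs_mult by linarith
    qed
    then show "AE x in M_pi. norm (f x * g x) \<le> norm ((f x)\<^sup>2 + (g x)\<^sup>2)"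
      by simp
  qed
qed

lemma L2_fun_add:
  assumes "f \<in> L2_fun" "g \<in> L2_fun"
  shows "(\<lambda>x. f x + g x) \<in> L2_fun"
proof -
  have "integrable M_pi (\<lambda>x. (f x)\<^sup>2 + (g x)\<^sup>2 + 2 * (f x * g x))"
    using assms L2_fun_mult_integrable[OF assms] by (auto simp: L2_fun_def)
  then show ?thesis
    using assms by (auto simp: L2_fun_def power2_sum mult.assoc)
qed

lemma L2_fun_scale: "f \<in> L2_fun \<Longrightarrow> (\<lambda>x. c * f x) \<in> L2_fun"
  by (auto simp: L2_fun_def power_mult_distrib)

lemma L2_fun_zero: "(\<lambda>x. 0) \<in> L2_fun"
  by (auto simp: L2_fun_def)

lemma L2_fun_continuous:
  assumes "continuous_on {0..pi} f"
  shows "f \<in> L2_fun"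
proof -
  have "integrable (lebesgue_on {0..pi}) (\<lambda>x. (f x)\<^sup>2)"
    using assms by (intro continuous_imp_integrable_real continuous_intros)
  then have "set_integrable lebesgue {0..pi} (\<lambda>x. (f x)\<^sup>2)"
    by (simp add: set_integrable_def integrable_restrict_space)
  then have "set_integrable lebesgue {0<..<pi} (\<lambda>x. (f x)\<^sup>2)"
    by (rule set_integrable_subset) auto
  then have "integrable M_pi (\<lambda>x. (f x)\<^sup>2)"
    by (simp add: set_integrable_def integrable_restrict_space)
  moreover have "f \<in> borel_measurable M_pi"
    by (rule continuous_imp_measurable_on_sets_lebesgue)
       (auto intro: continuous_on_subset[OF assms])
  ultimately show ?thesis by (simp add: L2_fun_def)
qed

quotient_type L2_pi = "real \<Rightarrow> real" / partial: L2_eq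
  morphisms L2_rep L2_class
proof (rule part_equivpI)
  show "\<exists>f. L2_eq f f" using L2_fun_zero by (auto simp: L2_eq_def)
  show "symp L2_eq" by (auto simp: symp_def L2_eq_def)
  show "transp L2_eq" by (rule transpI) (auto simp: L2_eq_def)
qed

instantiation L2_pi :: real_inner
begin

lift_definition zero_L2_pi :: L2_pi is "\<lambda>x. 0"
  by (simp add: L2_eq_def L2_fun_zero)

lift_definition plus_L2_pi :: "L2_pi \<Rightarrow> L2_pi \<Rightarrow> L2_pi" is "\<lambda>f g x. f x + g x"
  by (auto simp: L2_eq_def L2_fun_add)

lift_definition scaleR_L2_pi :: "real \<Rightarrow> L2_pi \<Rightarrow> L2_pi" is "\<lambda>c f x. c * f x"
  by (auto simp: L2_eq_def L2_fun_scale)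

lift_definition inner_L2_pi :: "L2_pi \<Rightarrow> L2_pi \<Rightarrow> real"
  is "\<lambda>f g. \<integral>x. f x * g x \<partial>M_pi"
  by (rule integral_cong_AE) (auto simp: L2_eq_def L2_fun_def)

definition uminus_L2_pi :: "L2_pi \<Rightarrow> L2_pi" where
  "uminus_L2_pi u = (- 1) *\<^sub>R u"

definition minus_L2_pi :: "L2_pi \<Rightarrow> L2_pi \<Rightarrow> L2_pi" where
  "minus_L2_pi u v = u + (- v)"

definition norm_L2_pi :: "L2_pi \<Rightarrow> real" where
  "norm_L2_pi u = sqrt (u \<bullet> u)"

definition sgn_L2_pi :: "L2_pi \<Rightarrow> L2_pi" where
  "sgn_L2_pi u = inverse (norm u) *\<^sub>R u"

definition dist_L2_pi :: "L2_pi \<Rightarrow> L2_pi \<Rightarrow> real" where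
  "dist_L2_pi u v = norm (u - v)"

definition uniformity_L2_pi :: "(L2_pi \<times> L2_pi) filter" where
  "uniformity_L2_pi = (INF e\<in>{0<..}. principal {(u, v). dist u v < e})"

definition open_L2_pi :: "L2_pi set \<Rightarrow> bool" where
  "open_L2_pi U \<longleftrightarrow> (\<forall>u\<in>U. eventually (\<lambda>(u', v). u' = u \<longrightarrow> v \<in> U) uniformity)"

instance
proof
  fix u v w :: L2_pi and a b :: real
  show "u + v + w = u + (v + w)"
    by transfer (auto simp: L2_eq_def add.assoc intro!: L2_fun_add)
  show "u + v = v + u"
    by transfer (auto simp: L2_eq_def add.commute intro!: L2_fun_add)
  show "0 + u = u"
    by transfer (auto simp: L2_eq_def)
  show "- u + u = 0"
    unfolding uminus_L2_pi_def
    by transfer (auto simp: L2_eq_def L2_fun_zero)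
  show "u - v = u + - v"
    by (rule minus_L2_pi_def)
  show "a *\<^sub>R (u + v) = a *\<^sub>R u + a *\<^sub>R v"
    by transfer (auto simp: L2_eq_def distrib_left intro!: L2_fun_add L2_fun_scale)
  show "(a + b) *\<^sub>R u = a *\<^sub>R u + b *\<^sub>R u"
    by transfer (auto simp: L2_eq_def distrib_right intro!: L2_fun_add L2_fun_scale)
  show "a *\<^sub>R b *\<^sub>R u = (a * b) *\<^sub>R u"
    by transfer (auto simp: L2_eq_def mult.assoc intro!: L2_fun_scale)
  show "1 *\<^sub>R u = u"
    by transfer (auto simp: L2_eq_def)
  show "dist u v = norm (u - v)"
    by (rule dist_L2_pi_def)
  show "sgn u = inverse (norm u) *\<^sub>R u"
    by (rule sgn_L2_pi_def)
  show "u \<bullet> v = v \<bullet> u"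
    by transfer (simp add: mult.commute)
  show "(u + v) \<bullet> w = u \<bullet> w + v \<bullet> w"
    by transfer (simp add: L2_eq_def distrib_right L2_fun_mult_integrable)
  show "(a *\<^sub>R u) \<bullet> v = a * (u \<bullet> v)"
    by transfer (simp add: mult.assoc)
  show "0 \<le> u \<bullet> u"
    by transfer simp
  show "u \<bullet> u = 0 \<longleftrightarrow> u = 0"
  proof transfer
    fix f assume f: "L2_eq f f"
    then have "integral\<^sup>L M_pi (\<lambda>x. f x * f x) = 0 \<longleftrightarrow> (AE x in M_pi. f x * f x = 0)"
      by (intro integral_nonneg_eq_0_iff_AE) (auto simp: L2_eq_def L2_fun_mult_integrable)
    then show "integral\<^sup>L M_pi (\<lambda>x. f x * f x) = 0 \<longleftrightarrow> L2_eq f (\<lambda>x. 0)"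
      using f by (simp add: L2_eq_def L2_fun_zero)
  qed
  show "norm u = sqrt (u \<bullet> u)"
    by (rule norm_L2_pi_def)
qed (fact uniformity_L2_pi_def open_L2_pi_def)+

end

text \<open>
  In dimension one, \<open>H\<^sup>1(0,\<pi>)\<close> consists of the absolutely continuous functions on
  \<open>[0,\<pi>]\<close> with derivative in \<open>L\<^sup>2(0,\<pi>)\<close>, that is, of the integral functions of elements of
  \<open>L\<^sup>2(0,\<pi>)\<close>. Thus \<open>has_L2_deriv u g\<close> says that \<open>u\<close> is the continuous representative
  of an element of \<open>H\<^sup>1(0,\<pi>)\<close> with weak derivative \<open>g\<close>; this element is in
  \<open>H\<^sub>0\<^sup>1(0,\<pi>)\<close> iff \<open>u 0 = u \<pi> = 0\<close>.
\<close>

definition has_L2_deriv :: "(real \<Rightarrow> real) \<Rightarrow> (real \<Rightarrow> real) \<Rightarrow> bool" where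
  "has_L2_deriv u g \<longleftrightarrow>
     g \<in> L2_fun \<and> (\<forall>x\<in>{0..pi}. u x = u 0 + integral {0..x} g)"

text \<open>
  \<open>L = - d\<^sup>2/dx\<^sup>2\<close> with domain \<open>H\<^sup>2(0,\<pi>) \<inter> H\<^sub>0\<^sup>1(0,\<pi>)\<close> is only densely defined, so it is
  given by its graph.
\<close>

definition L_op :: "(L2_pi \<times> L2_pi) set" where
  "L_op = {(L2_class u, L2_class (\<lambda>x. - w x)) | u v w.
     has_L2_deriv u v \<and> has_L2_deriv v w \<and> u 0 = 0 \<and> u pi = 0}"

lift_definition phi :: "nat \<Rightarrow> L2_pi" is "\<lambda>n x. sqrt (2 / pi) * sin (real n * x)"
  by (auto simp: L2_eq_def intro!: L2_fun_continuous continuous_intros)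

definition eigenvalue :: "('a::real_vector \<times> 'a) set \<Rightarrow> 'a \<Rightarrow> real" where
  "eigenvalue A e = (THE \<mu>. (e, \<mu> *\<^sub>R e) \<in> A)"

text \<open>
  \<open>f(A) v = \<Sum>\<^sub>n f(\<lambda>\<^sub>n) (v, e\<^sub>n) e\<^sub>n\<close>, where \<open>A e\<^sub>n = \<lambda>\<^sub>n e\<^sub>n\<close> for \<open>n = 1, 2, \<dots>\<close> (so \<open>e 0\<close> is not
  used). The value is meaningful only for those \<open>v\<close> for which the series converges in norm.
\<close>

definition spectral_fun ::
    "('a::real_inner \<times> 'a) set \<Rightarrow> (nat \<Rightarrow> 'a) \<Rightarrow> (real \<Rightarrow> real) \<Rightarrow> 'a \<Rightarrow> 'a" where
  "spectral_fun A e f v =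
     (\<Sum>n. f (eigenvalue A (e (Suc n))) *\<^sub>R ((v \<bullet> e (Suc n)) *\<^sub>R e (Suc n)))"

definition exp_sqrt_L :: "real \<Rightarrow> L2_pi \<Rightarrow> L2_pi" where
  "exp_sqrt_L y = spectral_fun L_op phi (\<lambda>\<mu>. exp (- y * sqrt \<mu>))"

definition B_op :: "real \<Rightarrow> L2_pi \<Rightarrow> L2_pi" where
  "B_op y v = v - exp_sqrt_L y v"

definition self_adjoint :: "('a::real_inner \<Rightarrow> 'a) \<Rightarrow> bool" where
  "self_adjoint T \<longleftrightarrow> (\<forall>u v. T u \<bullet> v = u \<bullet> T v)"

definition positive_op :: "('a::real_inner \<Rightarrow> 'a) \<Rightarrow> bool" where
  "positive_op T \<longleftrightarrow> (\<forall>v. 0 \<le> T v \<bullet> v)"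

definition boundedly_invertible :: "('a::real_normed_vector \<Rightarrow> 'a) \<Rightarrow> bool" where
  "boundedly_invertible T \<longleftrightarrow> bij T \<and> bounded_linear (inv T)"

lemma L2_class_eq_iff:
  assumes "f \<in> L2_fun" "g \<in> L2_fun"
  shows "L2_class f = L2_class g \<longleftrightarrow> (AE x in M_pi. f x = g x)"
  using Quotient3_rel[OF Quotient3_L2_pi, of f g] assms by (auto simp: L2_eq_def)

lemma scaleR_L2_class:
  "f \<in> L2_fun \<Longrightarrow> c *\<^sub>R L2_class f = L2_class (\<lambda>x. c * f x)"
  by (rule scaleR_L2_pi.abs_eq) (simp add: L2_eq_def)

lemma AE_M_pi_iff:
  "(AE x in M_pi. P x) \<longleftrightarrow> negligible {x \<in> {0<..<pi}. \<not> P x}"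
proof -
  have "(AE x in M_pi. P x) \<longleftrightarrow> (AE x in lebesgue. x \<in> {0<..<pi} \<longrightarrow> P x)"
    by (rule AE_restrict_space_iff) simp
  also have "\<dots> \<longleftrightarrow> {x. \<not> (x \<in> {0<..<pi} \<longrightarrow> P x)} \<in> null_sets lebesgue"
    by (simp add: completion.AE_iff_null_sets)
  finally show ?thesis
    by (simp add: negligible_iff_null_sets)
qed

lemma AE_eq_continuous_imp_eq:
  assumes ae: "AE x in M_pi. f x = (g x :: real)"
    and cont: "continuous_on {0..pi} f" "continuous_on {0..pi} g"
    and x: "x \<in> {0<..<pi}"
  shows "f x = g x"
proof -
  have c: "continuous_on {0<..<pi} (\<lambda>x. f x - g x)"
    by (intro continuous_intros continuous_on_subset[OF cont(1)] continuous_on_subset[OF cont(2)]) auto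
  have "open ({0<..<pi} \<inter> (\<lambda>x. f x - g x) -` (- {0}))"
    by (rule continuous_open_preimage[OF c]) auto
  moreover have "{0<..<pi} \<inter> (\<lambda>x. f x - g x) -` (- {0}) = {x \<in> {0<..<pi}. f x \<noteq> g x}"
    by auto
  ultimately have "open {x \<in> {0<..<pi}. f x \<noteq> g x}"
    by simp
  moreover have "negligible {x \<in> {0<..<pi}. f x \<noteq> g x}"
    using ae by (simp add: AE_M_pi_iff)
  ultimately have "{x \<in> {0<..<pi}. f x \<noteq> g x} = {}"
    using open_not_negligible by blast
  then show ?thesis using x by blast
qed

lemma AE_eq_imp_integral_eq:
  assumes ae: "AE x in M_pi. f x = (g x :: real)" and x: "x \<in> {0..pi}"
  shows "integral {0..x} f = integral {0..x} g"
proof (rule integral_spike)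
  show "negligible (insert 0 (insert pi {x \<in> {0<..<pi}. f x \<noteq> g x}))"
    using ae by (simp add: AE_M_pi_iff)
qed (use x in auto)

lemma L2_fun_integrable_on:
  assumes "g \<in> L2_fun"
  shows "g integrable_on {0..pi}"
proof -
  have "integrable M_pi (\<lambda>x. g x * 1)"
    by (intro L2_fun_mult_integrable assms L2_fun_continuous continuous_intros)
  then have "g integrable_on {0<..<pi}"
    using has_integral_integral_lebesgue_on[of "{0<..<pi}" g] by auto
  then show ?thesis
    by (simp add: integrable_on_open_interval_real)
qed

lemma has_L2_deriv_eq:
  "has_L2_deriv u g \<Longrightarrow> x \<in> {0..pi} \<Longrightarrow> u x = u 0 + integral {0..x} g"
  unfolding has_L2_deriv_def by blast

lemma has_L2_deriv_continuous:
  assumes "has_L2_deriv u g"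
  shows "continuous_on {0..pi} u"
proof -
  have "continuous_on {0..pi} (\<lambda>x. u 0 + integral {0..x} g)"
    using assms
    by (intro continuous_intros indefinite_integral_continuous_1 L2_fun_integrable_on)
       (simp add: has_L2_deriv_def)
  then show ?thesis
    by (rule continuous_on_eq) (rule has_L2_deriv_eq[OF assms, symmetric])
qed

lemma has_L2_deriv_DERIV:
  assumes u: "has_L2_deriv u g" and ae: "AE x in M_pi. g x = h x"
    and h: "continuous_on {0..pi} h" and x: "x \<in> {0<..<pi}"
  shows "(u has_real_derivative h x) (at x)"
proof -
  have eq: "u 0 + integral {0..y} h = u y" if "y \<in> {0<..<pi}" for y
  proof -
    have y: "y \<in> {0..pi}" using that by simp
    show ?thesis
      using has_L2_deriv_eq[OF u y] AE_eq_imp_integral_eq[OF ae y] by linarith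
  qed
  have "((\<lambda>y. u 0 + integral {0..y} h) has_real_derivative h x) (at x within {0..pi})"
    using integral_has_real_derivative[OF h, of x] x
    by (auto intro!: derivative_eq_intros)
  then have "((\<lambda>y. u 0 + integral {0..y} h) has_real_derivative h x) (at x)"
    using x at_within_Icc_at[of 0 x pi] by simp
  then show ?thesis
    by (rule has_field_derivative_transform_within_open[of _ _ _ "{0<..<pi}"]) (use x eq in auto)
qed

lemma has_L2_derivI:
  assumes "\<And>x. (u has_real_derivative g x) (at x)" "continuous_on {0..pi} g"
  shows "has_L2_deriv u g"
  unfolding has_L2_deriv_def
proof (intro conjI ballI L2_fun_continuous assms(2))
  fix x assume "x \<in> {0..pi}"
  then have "(g has_integral u x - u 0) {0..x}"
    using assms(1)
    by (intro fundamental_theorem_of_calculus)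
       (auto simp flip: has_real_derivative_iff_has_vector_derivative
             intro: has_field_derivative_at_within)
  then show "u x = u 0 + integral {0..x} g"
    by (simp add: integral_unique)
qed

lemma phi_eq: "phi n = L2_class (\<lambda>x. sqrt (2 / pi) * sin (real n * x))"
  by (rule phi.abs_eq)

lemma sine_L2_fun: "(\<lambda>x. c * sin (a * x)) \<in> L2_fun"
  by (intro L2_fun_continuous continuous_intros)

lemma L_op_phi: "(phi n, (real n)\<^sup>2 *\<^sub>R phi n) \<in> L_op"
proof -
  let ?s = "sqrt (2 / pi)"
  let ?u = "\<lambda>x. ?s * sin (real n * x)"
  let ?v = "\<lambda>x. ?s * real n * cos (real n * x)"
  let ?w = "\<lambda>x. - ((real n)\<^sup>2 * (?s * sin (real n * x)))"
  have "has_L2_deriv ?u ?v"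
    by (rule has_L2_derivI) (auto intro!: derivative_eq_intros continuous_intros)
  moreover have "has_L2_deriv ?v ?w"
    by (rule has_L2_derivI)
       (auto intro!: derivative_eq_intros continuous_intros simp: power2_eq_square)
  moreover have "?u 0 = 0" "?u pi = 0"
    by simp_all
  ultimately have "(L2_class ?u, L2_class (\<lambda>x. - ?w x)) \<in> L_op"
    unfolding L_op_def mem_Collect_eq by (intro exI conjI) (rule refl)
  then show ?thesis
    by (simp add: phi_eq scaleR_L2_class sine_L2_fun)
qed

lemma eigenvalue_L_op_phi:
  assumes "n \<ge> 1"
  shows "eigenvalue L_op (phi n) = (real n)\<^sup>2"
  unfolding eigenvalue_def
proof (rule the_equality)
  fix \<mu> assume "(phi n, \<mu> *\<^sub>R phi n) \<in> L_op"
  then obtain u v w where eqs: "phi n = L2_class u" "\<mu> *\<^sub>R phi n = L2_class (\<lambda>x. - w x)"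
    and u: "has_L2_deriv u v" and v: "has_L2_deriv v w"
    unfolding L_op_def by blast
  let ?s = "sqrt (2 / pi)"
  let ?p = "\<lambda>x. ?s * sin (real n * x)"
  let ?I = "{0<..<pi}"
  have uc: "continuous_on {0..pi} u" and vc: "continuous_on {0..pi} v"
    using u v by (auto intro: has_L2_deriv_continuous)
  have pc: "continuous_on {0..pi} (\<lambda>x. c * ?p x)" for c
    by (intro continuous_intros)
  have wL: "(\<lambda>x. - w x) \<in> L2_fun"
    using v L2_fun_scale[of w "-1"] by (simp add: has_L2_deriv_def)
  have "AE x in M_pi. ?p x = u x"
    using eqs(1) L2_class_eq_iff[OF sine_L2_fun L2_fun_continuous[OF uc]]
    by (simp add: phi_eq)
  from AE_eq_continuous_imp_eq[OF this _ uc] have pu: "?p x = u x" if "x \<in> ?I" for x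
    using pc[of 1] that by simp
  have "AE x in M_pi. \<mu> * ?p x = - w x"
    using eqs(2) L2_class_eq_iff[OF L2_fun_scale[OF sine_L2_fun] wL]
    by (simp add: phi_eq scaleR_L2_class sine_L2_fun)
  then have w: "AE x in M_pi. w x = (- \<mu>) * ?p x"
    by eventually_elim simp
  have v_eq: "v x = ?s * real n * cos (real n * x)" if x: "x \<in> ?I" for x
  proof -
    have "(u has_real_derivative v x) (at x)"
      by (rule has_L2_deriv_DERIV[OF u _ vc x]) simp
    moreover have "(?p has_real_derivative ?s * real n * cos (real n * x)) (at x)"
      by (auto intro!: derivative_eq_intros)
    then have "(u has_real_derivative ?s * real n * cos (real n * x)) (at x)"
      by (rule has_field_derivative_transform_within_open[of _ _ _ ?I]) (use x pu in auto)
    ultimately show ?thesis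
      by (rule DERIV_unique)
  qed
  have w_eq: "(- \<mu>) * ?p x = - ((real n)\<^sup>2 * ?p x)" if x: "x \<in> ?I" for x
  proof -
    have "(v has_real_derivative (- \<mu>) * ?p x) (at x)"
      by (rule has_L2_deriv_DERIV[OF v w pc x])
    moreover have "((\<lambda>x. ?s * real n * cos (real n * x)) has_real_derivative
        - ((real n)\<^sup>2 * ?p x)) (at x)"
      by (auto intro!: derivative_eq_intros simp: power2_eq_square)
    then have "(v has_real_derivative - ((real n)\<^sup>2 * ?p x)) (at x)"
      by (rule has_field_derivative_transform_within_open[of _ _ _ ?I]) (use x v_eq in auto)
    ultimately show ?thesis
      by (rule DERIV_unique)
  qed
  let ?x = "pi / (2 * real n)"
  have "real n * ?x = pi / 2" using assms by simp
  then have "?p ?x \<noteq> 0" by (simp only:) simp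
  moreover have "?x \<in> ?I" using assms by (auto simp: field_simps)
  ultimately show "\<mu> = (real n)\<^sup>2"
    using w_eq[of ?x] by simp
qed (rule L_op_phi)

lemma norm_phi:
  assumes "n \<ge> 1"
  shows "norm (phi n) = 1"
proof -
  have "sqrt (2 / pi) * a * (sqrt (2 / pi) * a) = 2 / pi * a\<^sup>2" for a
  proof -
    have "sqrt (2 / pi) * a * (sqrt (2 / pi) * a) = (sqrt (2 / pi) * sqrt (2 / pi)) * (a * a)"
      by (simp only: ac_simps)
    then show ?thesis
      by (simp only: power2_eq_square) simp
  qed
  then have "phi n \<bullet> phi n = (\<integral>x. 2 / pi * (sin (real n * x))\<^sup>2 \<partial>M_pi)"
    unfolding phi_eq
    by (subst inner_L2_pi.abs_eq)
       (simp_all only: L2_eq_def sine_L2_fun, simp_all)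
  also have "\<dots> = integral {0<..<pi} (\<lambda>x. 2 / pi * (sin (real n * x))\<^sup>2)"
  proof (rule lebesgue_integral_eq_integral)
    show "integrable M_pi (\<lambda>x. 2 / pi * (sin (real n * x))\<^sup>2)"
      using L2_fun_mult_integrable[OF sine_L2_fun[of "2 / pi" "real n"] sine_L2_fun[of 1 "real n"]]
      by (simp add: power2_eq_square mult.assoc)
  qed simp
  also have "\<dots> = integral {0..pi} (\<lambda>x. 2 / pi * (sin (real n * x))\<^sup>2)"
    by (rule integral_open_interval_real[symmetric])
  also have "\<dots> = 1"
  proof -
    let ?F = "\<lambda>x. x / pi - sin (real n * x) * cos (real n * x) / (real n * pi)"
    have "((\<lambda>x. 2 / pi * (sin (real n * x))\<^sup>2) has_integral ?F pi - ?F 0) {0..pi}"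
    proof (rule fundamental_theorem_of_calculus)
      fix x
      have "(?F has_real_derivative
          1 / pi - (real n * cos (real n * x) * cos (real n * x)
            - sin (real n * x) * (real n * sin (real n * x))) / (real n * pi)) (at x)"
        using assms by (auto intro!: derivative_eq_intros simp: field_simps)
      moreover have "1 / pi - (real n * cos (real n * x) * cos (real n * x)
            - sin (real n * x) * (real n * sin (real n * x))) / (real n * pi)
          = (1 - (cos (real n * x))\<^sup>2 + (sin (real n * x))\<^sup>2) / pi"
        using assms by (simp add: field_simps power2_eq_square)
      moreover have "\<dots> = 2 / pi * (sin (real n * x))\<^sup>2"
        by (simp add: cos_squared_eq)
      ultimately have "(?F has_real_derivative 2 / pi * (sin (real n * x))\<^sup>2) (at x)"
        by simp
      then show "(?F has_vector_derivative 2 / pi * (sin (real n * x))\<^sup>2) (at x within {0..pi})"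
        by (simp add: has_real_derivative_iff_has_vector_derivative has_vector_derivative_at_within)
    qed simp
    moreover have "?F pi - ?F 0 = 1" by simp
    ultimately show ?thesis by (simp only: integral_unique)
  qed
  finally show ?thesis by (simp add: norm_eq_sqrt_inner)
qed

lemma exp_sqrt_L_eq:
  "exp_sqrt_L y v =
     (\<Sum>n. exp (- real (Suc n) * y) *\<^sub>R ((v \<bullet> phi (Suc n)) *\<^sub>R phi (Suc n)))"
  by (simp add: exp_sqrt_L_def spectral_fun_def eigenvalue_L_op_phi mult.commute
      del: of_nat_Suc)

end

theory Submission
  imports Defs
begin

text \<open>
  The semigroup operator \<open>e\<^bsup>-y\<surd>L\<^esup>\<close> is diagonal with respect to the orthonormal sequence
  \<open>\<phi>\<^sub>1, \<phi>\<^sub>2, \<dots>\<close>, with coefficients \<open>a\<^sub>n = e\<^bsup>-ny\<^esup>\<close> that are summable and lie in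
  \<open>[0, e\<^sup>-\<^sup>y]\<close>. Everything follows from these three properties.

  Write \<open>D\<^sub>a v = \<Sum>\<^sub>n a\<^sub>n (v, \<phi>\<^sub>n) \<phi>\<^sub>n\<close>. Because \<open>(v, \<phi>\<^sub>n)\<close> is bounded by \<open>\<parallel>v\<parallel>\<close> and
  the \<open>\<phi>\<^sub>n\<close> are uniformly bounded continuous functions, the Weierstrass test gives a continuous
  function as uniform limit of the series, and on a bounded interval uniform convergence implies
  convergence in \<open>L\<^sup>2\<close> (\<open>summable_scaleR_phi\<close>). Then \<open>D\<^sub>a\<close> is bounded and symmetric, and
  \<open>(D\<^sub>a v, v) = \<Sum>\<^sub>n a\<^sub>n (v, \<phi>\<^sub>n)\<^sup>2\<close> is between \<open>0\<close> and \<open>e\<^sup>-\<^sup>y \<parallel>v\<parallel>\<^sup>2\<close> by Bessel's inequality;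
  this is the two-sided bound for \<open>B = I - D\<^sub>a\<close>.

  The inverse is explicit: from \<open>(1 - a\<^sub>n)\<^sup>-\<^sup>1 = 1 + b\<^sub>n\<close> with \<open>b\<^sub>n = a\<^sub>n / (1 - a\<^sub>n)\<close>, which is
  again summable, one gets \<open>B\<^sup>-\<^sup>1 = I + D\<^sub>b\<close> (\<open>inverse_id_minus_diag\<close>). Coercivity of \<open>B\<close> with
  constant \<open>1 - e\<^sup>-\<^sup>y\<close> bounds the norm of \<open>B\<^sup>-\<^sup>1\<close> from above, and the eigenvector \<open>\<phi>\<^sub>1\<close> of \<open>B\<close>,
  whose eigenvalue is this same constant, shows that the bound is attained
  (\<open>onorm_inv_coercive\<close>).
\<close>

section \<open>Coercive operators\<close>

lemma coercive_imp_norm_lower_bound: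
  fixes T :: "'a::real_inner \<Rightarrow> 'a"
  assumes "c * (norm v)\<^sup>2 \<le> T v \<bullet> v"
  shows "c * norm v \<le> norm (T v)"
proof (cases "v = 0")
  case False
  have "c * norm v * norm v \<le> norm (T v) * norm v"
    using assms Cauchy_Schwarz_ineq2[of "T v" v] by (simp add: power2_eq_square mult.assoc)
  then show ?thesis
    using False by simp
qed simp

text \<open>
  Coercivity gives \<open>\<parallel>T\<^sup>-\<^sup>1\<parallel> \<le> 1 / c\<close>; an eigenvector for the coercivity constant itself makes the
  bound sharp.
\<close>

lemma onorm_inv_coercive:
  fixes T :: "'a::real_inner \<Rightarrow> 'a"
  assumes "bij T" and inv: "bounded_linear (inv T)" and "c > 0"
    and coercive: "\<And>v. c * (norm v)\<^sup>2 \<le> T v \<bullet> v"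
    and e: "T e = c *\<^sub>R e" "e \<noteq> 0"
  shows "onorm (inv T) = 1 / c"
proof (rule antisym)
  show "onorm (inv T) \<le> 1 / c"
  proof (rule onorm_bound)
    fix w
    have "c * norm (inv T w) \<le> norm (T (inv T w))"
      by (rule coercive_imp_norm_lower_bound) (rule coercive)
    then show "norm (inv T w) \<le> 1 / c * norm w"
      using \<open>c > 0\<close> \<open>bij T\<close> by (simp add: bij_is_surj surj_f_inv_f field_simps)
  qed (use \<open>c > 0\<close> in simp)
next
  have "inv T (c *\<^sub>R e) = e"
    using e \<open>bij T\<close> by (metis bij_is_inj inv_f_f)
  then have "norm e \<le> onorm (inv T) * (c * norm e)"
    using onorm[OF inv, of "c *\<^sub>R e"] \<open>c > 0\<close> by simp
  then show "1 / c \<le> onorm (inv T)"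
    using \<open>c > 0\<close> \<open>e \<noteq> 0\<close> by (simp add: field_simps)
qed

section \<open>Diagonal operators with summable coefficients\<close>

text \<open>
  The second assumption is the instance of completeness that makes the series of diagonal
  operators converge. In a function space it can be checked by exhibiting the pointwise sum of
  each series as its limit.
\<close>

locale orthonormal_sequence =
  fixes e :: "nat \<Rightarrow> 'a::real_inner"
  assumes orthonormal: "e i \<bullet> e j = (if i = j then 1 else 0)"
    and summable_scaleR: "summable (\<lambda>n. \<bar>c n\<bar>) \<Longrightarrow> summable (\<lambda>n. c n *\<^sub>R e n)"
begin

lemma norm_e: "norm (e n) = 1"
  by (simp add: norm_eq_sqrt_inner orthonormal)

lemma abs_inner_e_le: "\<bar>v \<bullet> e n\<bar> \<le> norm v"
  using Cauchy_Schwarz_ineq2[of v "e n"] by (simp add: norm_e)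

text \<open>
  Bessel's inequality: expand the square norm of the part of \<open>v\<close> that is orthogonal to the
  first \<open>N\<close> members of the sequence.
\<close>

lemma bessel: "(\<Sum>n<N. (v \<bullet> e n)\<^sup>2) \<le> (norm v)\<^sup>2"
proof -
  let ?p = "\<Sum>n<N. (v \<bullet> e n) *\<^sub>R e n"
  have vp: "v \<bullet> ?p = (\<Sum>n<N. (v \<bullet> e n)\<^sup>2)"
    by (simp add: inner_sum_right power2_eq_square)
  have "e n \<bullet> ?p = v \<bullet> e n" if "n < N" for n
    using that by (simp add: inner_sum_right orthonormal if_distrib sum.delta cong: if_cong)
  then have pp: "?p \<bullet> ?p = (\<Sum>n<N. (v \<bullet> e n)\<^sup>2)"
    by (simp add: inner_sum_left power2_eq_square)
  have "0 \<le> (v - ?p) \<bullet> (v - ?p)"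
    by (rule inner_ge_zero)
  also have "\<dots> = (norm v)\<^sup>2 - (\<Sum>n<N. (v \<bullet> e n)\<^sup>2)"
    using vp pp
    by (simp only: inner_diff_left inner_diff_right inner_commute[of ?p v] power2_norm_eq_inner)
  finally show ?thesis
    by simp
qed

definition diag :: "(nat \<Rightarrow> real) \<Rightarrow> 'a \<Rightarrow> 'a" where
  "diag a v = (\<Sum>n. (a n * (v \<bullet> e n)) *\<^sub>R e n)"

lemma diag_sums:
  assumes "summable (\<lambda>n. \<bar>a n\<bar>)"
  shows "(\<lambda>n. (a n * (v \<bullet> e n)) *\<^sub>R e n) sums diag a v"
proof -
  have "summable (\<lambda>n. \<bar>a n * (v \<bullet> e n)\<bar>)"
  proof (rule summable_comparison_test')
    show "summable (\<lambda>n. \<bar>a n\<bar> * norm v)"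
      using assms by (rule summable_mult2)
    show "norm \<bar>a n * (v \<bullet> e n)\<bar> \<le> \<bar>a n\<bar> * norm v" for n
      by (simp add: abs_mult mult_left_mono abs_inner_e_le)
  qed
  then show ?thesis
    unfolding diag_def by (rule summable_sums[OF summable_scaleR])
qed

lemma inner_diag_sums:
  assumes "summable (\<lambda>n. \<bar>a n\<bar>)"
  shows "(\<lambda>n. a n * (v \<bullet> e n) * (u \<bullet> e n)) sums (diag a v \<bullet> u)"
  using bounded_linear.sums[OF bounded_linear_inner_left[of u] diag_sums[OF assms, of v]]
  by (simp add: inner_commute[of u])

lemma inner_diag_e:
  assumes "summable (\<lambda>n. \<bar>a n\<bar>)"
  shows "diag a v \<bullet> e n = a n * (v \<bullet> e n)"
proof -
  have "(\<lambda>k. if k = n then a k * (v \<bullet> e k) else 0) sums (diag a v \<bullet> e n)"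
    using inner_diag_sums[OF assms, of v "e n"]
    by (simp add: orthonormal if_distrib eq_commute cong: if_cong)
  then show ?thesis
    using sums_single[of n "\<lambda>k. a k * (v \<bullet> e k)"] sums_unique2 by blast
qed

lemma diag_e: "diag a (e n) = a n *\<^sub>R e n"
proof -
  have "(\<lambda>k. (a k * (e n \<bullet> e k)) *\<^sub>R e k) = (\<lambda>k. if k = n then a k *\<^sub>R e k else 0)"
    by (auto simp: orthonormal)
  then show ?thesis
    using sums_unique[OF sums_single[of n "\<lambda>k. a k *\<^sub>R e k"]] by (simp add: diag_def)
qed

lemma diag_symmetric:
  assumes "summable (\<lambda>n. \<bar>a n\<bar>)"
  shows "diag a u \<bullet> v = u \<bullet> diag a v"
proof -
  have "(\<lambda>n. a n * (v \<bullet> e n) * (u \<bullet> e n)) sums (diag a u \<bullet> v)"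
    using inner_diag_sums[OF assms, of u v] by (simp add: mult_ac)
  then show ?thesis
    using sums_unique2[OF _ inner_diag_sums[OF assms, of v u]] by (simp add: inner_commute)
qed

lemma bounded_linear_diag:
  assumes "summable (\<lambda>n. \<bar>a n\<bar>)"
  shows "bounded_linear (diag a)"
proof (rule bounded_linear_intro)
  fix u v :: 'a and r :: real
  show "diag a (u + v) = diag a u + diag a v"
    using sums_unique[OF sums_add[OF diag_sums[OF assms, of u] diag_sums[OF assms, of v]]]
    by (simp add: diag_def[of a "u + v"] inner_add_left distrib_left scaleR_add_left)
  show "diag a (r *\<^sub>R v) = r *\<^sub>R diag a v"
    using sums_unique[OF sums_scaleR_right[OF diag_sums[OF assms, of v], of r]]
    by (simp add: diag_def[of a "r *\<^sub>R v"] mult_ac)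
  show "norm (diag a v) \<le> norm v * (\<Sum>n. \<bar>a n\<bar>)"
  proof (rule LIMSEQ_le_const2)
    show "(\<lambda>N. norm (\<Sum>n<N. (a n * (v \<bullet> e n)) *\<^sub>R e n)) \<longlonglongrightarrow> norm (diag a v)"
      using diag_sums[OF assms, of v] unfolding sums_def by (rule tendsto_norm)
    have "norm (\<Sum>n<N. (a n * (v \<bullet> e n)) *\<^sub>R e n) \<le> norm v * (\<Sum>n. \<bar>a n\<bar>)" for N
    proof -
      have "norm (\<Sum>n<N. (a n * (v \<bullet> e n)) *\<^sub>R e n) \<le> (\<Sum>n<N. \<bar>a n\<bar> * norm v)"
        by (rule sum_norm_le) (simp add: norm_e abs_mult mult_left_mono abs_inner_e_le)
      also have "\<dots> = norm v * (\<Sum>n<N. \<bar>a n\<bar>)"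
        by (simp add: sum_distrib_left mult.commute)
      also have "\<dots> \<le> norm v * (\<Sum>n. \<bar>a n\<bar>)"
        by (intro mult_left_mono sum_le_suminf assms) auto
      finally show ?thesis .
    qed
    then show "\<exists>N. \<forall>n\<ge>N. norm (\<Sum>n<n. (a n * (v \<bullet> e n)) *\<^sub>R e n) \<le> norm v * (\<Sum>n. \<bar>a n\<bar>)"
      by blast
  qed
qed

lemma diag_nonneg:
  assumes "summable (\<lambda>n. \<bar>a n\<bar>)" "\<And>n. 0 \<le> a n"
  shows "0 \<le> diag a v \<bullet> v"
  by (rule sums_le[OF _ sums_zero inner_diag_sums[OF assms(1)]])
     (simp add: assms(2) mult.assoc)

text \<open>
  The quadratic form is \<open>\<Sum>\<^sub>n a\<^sub>n (v, e\<^sub>n)\<^sup>2\<close>, so the upper bound is Bessel's inequality.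
\<close>

lemma diag_le:
  assumes "summable (\<lambda>n. \<bar>a n\<bar>)" "\<And>n. a n \<le> q" "0 \<le> q"
  shows "diag a v \<bullet> v \<le> q * (norm v)\<^sup>2"
proof (rule LIMSEQ_le_const2)
  show "(\<lambda>N. \<Sum>n<N. a n * (v \<bullet> e n) * (v \<bullet> e n)) \<longlonglongrightarrow> diag a v \<bullet> v"
    using inner_diag_sums[OF assms(1)] unfolding sums_def .
  have "(\<Sum>n<N. a n * (v \<bullet> e n) * (v \<bullet> e n)) \<le> q * (norm v)\<^sup>2" for N
  proof -
    have "(\<Sum>n<N. a n * (v \<bullet> e n) * (v \<bullet> e n)) \<le> (\<Sum>n<N. q * (v \<bullet> e n)\<^sup>2)"
      by (rule sum_mono) (simp add: power2_eq_square mult.assoc mult_right_mono assms(2))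
    also have "\<dots> \<le> q * (norm v)\<^sup>2"
      using mult_left_mono[OF bessel \<open>0 \<le> q\<close>] by (simp add: sum_distrib_left)
    finally show ?thesis .
  qed
  then show "\<exists>N. \<forall>n\<ge>N. (\<Sum>n<n. a n * (v \<bullet> e n) * (v \<bullet> e n)) \<le> q * (norm v)\<^sup>2"
    by blast
qed

text \<open>
  The last hypothesis says \<open>(1 - a\<^sub>n) (1 + b\<^sub>n) = 1\<close>, and the conclusion says that \<open>I + D\<^sub>b\<close> is a
  right inverse of \<open>I - D\<^sub>a\<close>. Replacing \<open>(a, b)\<close> by \<open>(-b, -a)\<close> preserves the hypotheses, so that
  the lemma also gives the left inverse.
\<close>

lemma diag_resolvent:
  assumes a: "summable (\<lambda>n. \<bar>a n\<bar>)" and b: "summable (\<lambda>n. \<bar>b n\<bar>)"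
    and ab: "\<And>n. b n - a n = a n * b n"
  shows "diag b v - diag a v = diag a (diag b v)"
proof -
  have "(\<lambda>n. (a n * (diag b v \<bullet> e n)) *\<^sub>R e n) sums (diag b v - diag a v)"
    using sums_diff[OF diag_sums[OF b, of v] diag_sums[OF a, of v]]
    by (simp add: inner_diag_e[OF b] flip: scaleR_diff_left left_diff_distrib mult.assoc ab)
  then show ?thesis
    using diag_sums[OF a] sums_unique2 by blast
qed

lemma diag_uminus:
  assumes "summable (\<lambda>n. \<bar>a n\<bar>)"
  shows "diag (\<lambda>n. - a n) v = - diag a v"
  using sums_unique[OF sums_minus[OF diag_sums[OF assms, of v]]] by (simp add: diag_def)

text \<open>
  The coefficients \<open>b\<^sub>n = a\<^sub>n / (1 - a\<^sub>n)\<close> satisfy \<open>0 \<le> b\<^sub>n \<le> a\<^sub>n / (1 - q)\<close>, which makes them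
  summable. They define the inverse \<open>I + D\<^sub>b\<close>.
\<close>

lemma inverse_id_minus_diag:
  assumes a: "summable (\<lambda>n. \<bar>a n\<bar>)" and pos: "\<And>n. 0 \<le> a n"
    and le: "\<And>n. a n \<le> q" and "q < 1"
  shows "bij (\<lambda>v. v - diag a v) \<and> bounded_linear (inv (\<lambda>v. v - diag a v))"
proof -
  define b where "b n = a n / (1 - a n)" for n
  have less_1: "a n < 1" for n
    using le[of n] \<open>q < 1\<close> by simp
  have b: "summable (\<lambda>n. \<bar>b n\<bar>)"
  proof (rule summable_comparison_test')
    show "summable (\<lambda>n. \<bar>a n\<bar> / (1 - q))"
      using a by (rule summable_divide)
    show "norm \<bar>b n\<bar> \<le> \<bar>a n\<bar> / (1 - q)" for n
      using less_1[of n] le[of n] pos[of n] \<open>q < 1\<close>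
      by (simp add: b_def divide_left_mono)
  qed
  have ab: "b n - a n = a n * b n" for n
    using less_1[of n] by (simp add: b_def field_simps)
  let ?T = "\<lambda>v. v - diag a v" and ?S = "\<lambda>v. v + diag b v"
  interpret A: bounded_linear "diag a" by (rule bounded_linear_diag[OF a])
  interpret B: bounded_linear "diag b" by (rule bounded_linear_diag[OF b])
  have TS: "?T (?S v) = v" for v
    using diag_resolvent[OF a b ab, of v] by (simp add: A.add algebra_simps)
  have ST: "?S (?T v) = v" for v
  proof -
    have "diag b v - diag a v = diag b (diag a v)"
      using diag_resolvent[of "\<lambda>n. - b n" "\<lambda>n. - a n" v] a b ab
      by (simp add: diag_uminus B.neg mult.commute)
    then show ?thesis
      by (simp add: B.diff algebra_simps)
  qed
  have "bij ?T"
    by (rule o_bij[of ?S]) (auto simp: fun_eq_iff TS ST)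
  moreover have "inv ?T = ?S"
    by (rule inv_equality) (auto simp: TS ST)
  moreover have "bounded_linear ?S"
    by (intro bounded_linear_add bounded_linear_ident bounded_linear_diag b)
  ultimately show ?thesis
    by simp
qed

end

section \<open>Sine series in \<open>L\<^sup>2(0,\<pi>)\<close>\<close>

lemma inner_L2_class:
  assumes "f \<in> L2_fun" "g \<in> L2_fun"
  shows "L2_class f \<bullet> L2_class g = (\<integral>x. f x * g x \<partial>M_pi)"
  using assms by (intro inner_L2_pi.abs_eq) (simp_all add: L2_eq_def)

lemma inner_L2_class_continuous:
  assumes "continuous_on {0..pi} f" "continuous_on {0..pi} g"
  shows "L2_class f \<bullet> L2_class g = integral {0..pi} (\<lambda>x. f x * g x)"
proof -
  have fg: "f \<in> L2_fun" "g \<in> L2_fun"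
    using assms by (auto intro: L2_fun_continuous)
  have "L2_class f \<bullet> L2_class g = integral {0<..<pi} (\<lambda>x. f x * g x)"
    unfolding inner_L2_class[OF fg]
    by (rule lebesgue_integral_eq_integral) (simp_all add: L2_fun_mult_integrable fg)
  then show ?thesis
    by (simp add: integral_open_interval_real)
qed

lemma norm_L2_class_le:
  assumes f: "continuous_on {0..pi} f" and le: "\<And>x. x \<in> {0..pi} \<Longrightarrow> \<bar>f x\<bar> \<le> C"
  shows "norm (L2_class f) \<le> sqrt pi * C"
proof -
  have "0 \<le> C"
    using le[of 0] by simp
  have "(norm (L2_class f))\<^sup>2 = integral {0..pi} (\<lambda>x. f x * f x)"
    using inner_L2_class_continuous[OF f f] by (simp add: power2_norm_eq_inner)
  also have "\<dots> \<le> integral {0..pi} (\<lambda>x. C\<^sup>2)"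
  proof (rule integral_le)
    show "(\<lambda>x. f x * f x) integrable_on {0..pi}"
      by (intro integrable_continuous_real continuous_intros f)
    show "f x * f x \<le> C\<^sup>2" if "x \<in> {0..pi}" for x
      using power_mono[OF le[OF that], of 2] by (simp add: power2_eq_square)
  qed (rule integrable_const_ivl)
  also have "\<dots> = (sqrt pi * C)\<^sup>2"
    by (simp add: power_mult_distrib)
  finally show ?thesis
    by (rule power2_le_imp_le) (simp add: \<open>0 \<le> C\<close>)
qed

lemma L2_class_add:
  "f \<in> L2_fun \<Longrightarrow> g \<in> L2_fun \<Longrightarrow> L2_class f + L2_class g = L2_class (\<lambda>x. f x + g x)"
  by (intro plus_L2_pi.abs_eq) (simp_all add: L2_eq_def)

lemma L2_class_diff:
  assumes "f \<in> L2_fun" "g \<in> L2_fun"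
  shows "L2_class f - L2_class g = L2_class (\<lambda>x. f x - g x)"
proof -
  have "L2_class f - L2_class g = L2_class f + L2_class (\<lambda>x. - 1 * g x)"
    unfolding minus_L2_pi_def uminus_L2_pi_def by (simp only: scaleR_L2_class assms(2))
  also have "\<dots> = L2_class (\<lambda>x. f x + - 1 * g x)"
    by (rule L2_class_add[OF assms(1) L2_fun_scale[OF assms(2)]])
  finally show ?thesis
    by simp
qed

lemma L2_class_sum:
  fixes N :: nat
  assumes "\<And>n. f n \<in> L2_fun"
  shows "(\<Sum>n<N. L2_class (f n)) = L2_class (\<lambda>x. \<Sum>n<N. f n x) \<and> (\<lambda>x. \<Sum>n<N. f n x) \<in> L2_fun"
proof (induction N)
  case 0
  show ?case
    by (simp add: L2_fun_zero zero_L2_pi_def)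
next
  case (Suc N)
  then show ?case
    using assms by (simp add: L2_class_add L2_fun_add)
qed

text \<open>
  The limit exists as a function: the Weierstrass test yields a continuous uniform limit of the
  partial sums, and uniform convergence on the bounded interval dominates convergence in norm.
\<close>

lemma summable_scaleR_phi:
  assumes c: "summable (\<lambda>n. \<bar>c n\<bar>)"
  shows "summable (\<lambda>n. c n *\<^sub>R phi (k n))"
proof -
  define p where "p n x = c n * (sqrt (2 / pi) * sin (real (k n) * x))" for n x
  define S where "S x = (\<Sum>n. p n x)" for x
  have p_cont: "continuous_on {0..pi} (p n)" for n
    unfolding p_def by (intro continuous_intros)
  have partial_cont: "continuous_on {0..pi} (\<lambda>x. \<Sum>n<N. p n x)" for N
    by (intro continuous_intros p_cont)
  have unif: "uniform_limit {0..pi} (\<lambda>N x. \<Sum>n<N. p n x) S sequentially"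
    unfolding S_def
  proof (rule Weierstrass_m_test)
    show "summable (\<lambda>n. \<bar>c n\<bar> * sqrt (2 / pi))"
      using c by (rule summable_mult2)
    show "norm (p n x) \<le> \<bar>c n\<bar> * sqrt (2 / pi)" for n x
      by (auto simp: p_def abs_mult intro!: mult_left_mono mult_left_le)
  qed
  have S_cont: "continuous_on {0..pi} S"
    by (rule uniform_limit_theorem[OF _ unif]) (simp_all add: partial_cont)
  have c_phi: "c n *\<^sub>R phi (k n) = L2_class (p n)" for n
    by (simp add: phi_eq scaleR_L2_class sine_L2_fun p_def[abs_def])
  have partial: "(\<Sum>n<N. c n *\<^sub>R phi (k n)) = L2_class (\<lambda>x. \<Sum>n<N. p n x)" for N
    using L2_class_sum[of p N] p_cont by (simp add: c_phi L2_fun_continuous)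
  have "(\<lambda>N. \<Sum>n<N. c n *\<^sub>R phi (k n)) \<longlonglongrightarrow> L2_class S"
  proof (rule tendstoI)
    fix \<epsilon> :: real assume "\<epsilon> > 0"
    define \<delta> where "\<delta> = \<epsilon> / (2 * sqrt pi)"
    have "\<delta> > 0"
      using \<open>\<epsilon> > 0\<close> by (simp add: \<delta>_def)
    from uniform_limitD[OF unif this]
    show "\<forall>\<^sub>F N in sequentially. dist (\<Sum>n<N. c n *\<^sub>R phi (k n)) (L2_class S) < \<epsilon>"
    proof eventually_elim
      case (elim N)
      have "dist (\<Sum>n<N. c n *\<^sub>R phi (k n)) (L2_class S)
          = norm (L2_class (\<lambda>x. (\<Sum>n<N. p n x) - S x))"
        by (simp add: partial dist_norm L2_class_diff L2_fun_continuous partial_cont S_cont)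
      also have "\<dots> \<le> sqrt pi * \<delta>"
      proof (rule norm_L2_class_le)
        show "continuous_on {0..pi} (\<lambda>x. (\<Sum>n<N. p n x) - S x)"
          by (intro continuous_on_diff partial_cont S_cont)
        show "\<bar>(\<Sum>n<N. p n x) - S x\<bar> \<le> \<delta>" if "x \<in> {0..pi}" for x
          using elim that by (force simp: dist_real_def)
      qed
      also have "\<dots> < \<epsilon>"
        using \<open>\<epsilon> > 0\<close> by (simp add: \<delta>_def)
      finally show ?case .
    qed
  qed
  then show ?thesis
    unfolding summable_def sums_def by blast
qed

lemma phi_orthogonal:
  assumes "m \<noteq> n"
  shows "phi m \<bullet> phi n = 0"
proof (cases "m + n = 0")
  case True
  with assms show ?thesis by simp
next
  case False
  let ?f = "\<lambda>x. sqrt (2 / pi) * sin (real m * x) * (sqrt (2 / pi) * sin (real n * x))"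
  \<comment> \<open>The frequencies are integers because sines of integer multiples of \<open>\<pi>\<close> vanish.\<close>
  define d s where "d = int m - int n" and "s = int m + int n"
  let ?F = "\<lambda>x. (sin (real_of_int d * x) / real_of_int d - sin (real_of_int s * x) / real_of_int s) / pi"
  have nz: "real_of_int d \<noteq> 0" "real_of_int s \<noteq> 0"
    using assms False by (auto simp: d_def s_def)
  have "(?f has_integral ?F pi - ?F 0) {0..pi}"
  proof (rule fundamental_theorem_of_calculus)
    fix x
    have F: "(?F has_real_derivative (cos (real_of_int d * x) - cos (real_of_int s * x)) / pi) (at x)"
      using nz by (auto intro!: derivative_eq_intros)
    have "?f x = (sqrt (2 / pi) * sqrt (2 / pi)) * (sin (real m * x) * sin (real n * x))"
      by (simp only: mult_ac)
    also have "\<dots> = 2 / pi * (sin (real m * x) * sin (real n * x))"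
      by simp
    also have "\<dots> = (cos (real m * x - real n * x) - cos (real m * x + real n * x)) / pi"
      unfolding sin_times_sin by (simp add: field_simps)
    also have "\<dots> = (cos (real_of_int d * x) - cos (real_of_int s * x)) / pi"
      by (simp add: d_def s_def left_diff_distrib distrib_right)
    finally have "(?F has_real_derivative ?f x) (at x)"
      using F by (simp only:)
    then show "(?F has_vector_derivative ?f x) (at x within {0..pi})"
      by (simp only: has_real_derivative_iff_has_vector_derivative has_vector_derivative_at_within)
  qed simp
  then have integral_f: "integral {0..pi} ?f = ?F pi - ?F 0"
    by (rule integral_unique)
  have "sin (real_of_int k * pi) = 0" for k
    unfolding sin_zero_iff_int2 by blast
  then have F_0: "?F pi - ?F 0 = 0"
    by simp
  have cont: "continuous_on {0..pi} (\<lambda>x. sqrt (2 / pi) * sin (real j * x))" for j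
    by (intro continuous_intros)
  show ?thesis
    unfolding phi_eq by (subst inner_L2_class_continuous[OF cont cont]) (rule trans[OF integral_f F_0])
qed

interpretation phi: orthonormal_sequence "\<lambda>n. phi (Suc n)"
proof
  show "phi (Suc i) \<bullet> phi (Suc j) = (if i = j then 1 else 0)" for i j
    using norm_phi[of "Suc i"] phi_orthogonal[of "Suc i" "Suc j"]
    by (cases "i = j") (simp_all add: norm_eq_sqrt_inner)
qed (rule summable_scaleR_phi)

section \<open>The operator \<open>I - e\<^bsup>-y\<surd>L\<^esup>\<close>\<close>

lemma B_op_eq_diag: "B_op y = (\<lambda>v. v - phi.diag (\<lambda>n. exp (- real (Suc n) * y)) v)"
  by (rule ext) (simp only: B_op_def exp_sqrt_L_eq phi.diag_def scaleR_scaleR)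

lemma summable_exp_multiples:
  fixes y :: real
  assumes "y > 0"
  shows "summable (\<lambda>n. \<bar>exp (- real (Suc n) * y)\<bar>)"
proof -
  have "exp (- real (Suc n) * y) = exp (- y) ^ Suc n" for n
    by (simp add: mult.commute flip: exp_of_nat_mult del: of_nat_Suc power_Suc)
  moreover have "summable (\<lambda>n. exp (- y) ^ Suc n)"
    unfolding summable_Suc_iff using assms by (intro summable_geometric) simp
  ultimately show ?thesis
    by simp
qed

theorem proposition2p1:
  fixes y0 :: real
  assumes "y0 > 0"
  shows "bounded_linear (B_op y0)
    \<and> self_adjoint (B_op y0)
    \<and> positive_op (B_op y0)
    \<and> boundedly_invertible (B_op y0)
    \<and> (\<forall>v. (1 - exp (- y0)) * (norm v)\<^sup>2 \<le> B_op y0 v \<bullet> v \<and> B_op y0 v \<bullet> v \<le> (norm v)\<^sup>2)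
    \<and> onorm (inv (B_op y0)) = 1 / (1 - exp (- y0))"
proof -
  define a where "a n = exp (- real (Suc n) * y0)" for n
  define q where "q = exp (- y0)"
  have B: "B_op y0 = (\<lambda>v. v - phi.diag a v)"
    by (simp only: B_op_eq_diag a_def[abs_def])
  have a: "summable (\<lambda>n. \<bar>a n\<bar>)" "\<And>n. 0 \<le> a n"
    using summable_exp_multiples[OF assms] by (simp_all add: a_def del: of_nat_Suc)
  have le: "a n \<le> q" for n
    using assms by (simp add: a_def q_def left_diff_distrib)
  have q: "0 \<le> q" "q < 1"
    using assms by (simp_all add: q_def)
  have bounded: "bounded_linear (B_op y0)"
    unfolding B by (intro bounded_linear_sub bounded_linear_ident phi.bounded_linear_diag a)
  have selfadj: "self_adjoint (B_op y0)"
    by (simp add: self_adjoint_def B inner_diff_left inner_diff_right phi.diag_symmetric[OF a(1)])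
  have lower: "(1 - q) * (norm v)\<^sup>2 \<le> B_op y0 v \<bullet> v" for v
    using phi.diag_le[OF a(1) le q(1), of v]
    by (simp add: B inner_diff_left left_diff_distrib power2_norm_eq_inner)
  have upper: "B_op y0 v \<bullet> v \<le> (norm v)\<^sup>2" for v
    using phi.diag_nonneg[OF a, of v] by (simp add: B inner_diff_left power2_norm_eq_inner)
  have positive: "positive_op (B_op y0)"
    unfolding positive_op_def
  proof
    fix v :: L2_pi
    have "0 \<le> (1 - q) * (norm v)\<^sup>2"
      using q by simp
    then show "0 \<le> B_op y0 v \<bullet> v"
      using lower[of v] by linarith
  qed
  have inv: "bij (B_op y0)" "bounded_linear (inv (B_op y0))"
    using phi.inverse_id_minus_diag[OF a le q(2)] unfolding B by blast+
  have "B_op y0 (phi 1) = (1 - q) *\<^sub>R phi 1"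
    using phi.diag_e[of a 0] by (simp add: B a_def q_def scaleR_diff_left)
  moreover have "phi 1 \<noteq> 0"
    using norm_phi[of 1] by auto
  ultimately have "onorm (inv (B_op y0)) = 1 / (1 - q)"
    using q by (intro onorm_inv_coercive[OF inv _ lower]) auto
  then show ?thesis
    using bounded selfadj positive inv lower upper by (simp add: boundedly_invertible_def q_def)
qed

end
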